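(* Consider the baseline-category logit model with nonproportional odds: $\log(\pi_{ij}/\pi_{iJ})=\mathbf h_j^T(\mathbf x_i)\boldsymbol\beta_j$ for $i=1,\dots,m$, $j=1,\dots,J-1$. Suppose $\mathbf h_1(\mathbf x_i)=\cdots=\mathbf h_{J-1}(\mathbf x_i)$ for all $i=1,\dots,m$. Then all orders of response categories are equivalent; that is, $\sigma_1\sim\sigma_2$ for all permutations $\sigma_1,\sigma_2$ of $\{1,\dots,J\}$.
   Context: Setting. Let $d\ge1$, $m\ge1$, $J\ge3$. The data are $\{(\mathbf x_i,\mathbf Y_i): i=1,\dots,m\}$, where $\mathbf x_1,\dots,\mathbf x_m\in\mathbb R^d$ are distinct covariate settings and $\mathbf Y_i=(Y_{i1},\dots,Y_{iJ})^T$ is a vector of nonnegative integer counts with $n_i=\sum_{j=1}^JY_{ij}>0$. The model assumes $\mathbf Y_i\sim\mathrm{Multinomial}(n_i;\pi_{i1},\dots,\pi_{iJ})$ independently over $i$, with $\pi_{ij}>0$ and $\sum_{j=1}^J\pi_{ij}=1$. Model. $\mathbf h_j:\mathbb R^d\to\mathbb R^{p_j}$ ($j=1,\dots,J-1$) are known predictor functions (under the hypothesis of the claim, all $p_j$ are equal), and the unknown parameter is $\boldsymbol\theta=(\boldsymbol\beta_1^T,\dots,\boldsymbol\beta_{J-1}^T)^T$ with $\boldsymbol\beta_j\in\mathbb R^{p_j}$, ranging over $\boldsymbol\Theta=\mathbb R^p$, $p=p_1+\cdots+p_{J-1}$. For $\boldsymbol\theta\in\boldsymbol\Theta$, $(\pi_{i1}(\boldsymbol\theta),\dots,\pi_{iJ}(\boldsymbol\theta))$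 denotes the unique positive probability vector satisfying the model equations at $\mathbf x_i$. Orders and equivalence. An order is a permutation $\sigma$ of $\{1,\dots,J\}$. Fitting the model with order $\sigma$ means fitting it to the permuted data $\mathbf Y_i^\sigma=(Y_{i\sigma(1)},\dots,Y_{i\sigma(J)})^T$, so the likelihood function with order $\sigma$ is $$L_\sigma(\boldsymbol\theta)=\prod_{i=1}^m\frac{n_i!}{\prod_{j=1}^JY_{i\sigma(j)}!}\prod_{j=1}^J\pi_{ij}(\boldsymbol\theta)^{Y_{i\sigma(j)}} .$$ Two orders are equivalent, $\sigma_1\sim\sigma_2$, if $\sup_{\boldsymbol\theta\in\boldsymbol\Theta}L_{\sigma_1}(\boldsymbol\theta)=\sup_{\boldsymbol\theta\in\boldsymbol\Theta}L_{\sigma_2}(\boldsymbol\theta)$. *)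

theory Defs
  imports "HOL-Analysis.Analysis" "HOL-Combinatorics.Permutations"
begin

text \<open>
  Categories are \<open>1, \<dots>, J\<close>, covariate settings are \<open>1, \<dots>, m\<close>, and \<open>Y i j\<close> is the count of
  category \<open>j\<close> at setting \<open>i\<close>. A parameter is the family \<open>\<theta> = (\<beta>\<^sub>1, \<dots>, \<beta>\<^bsub>J-1\<^esub>)\<close>; families are
  functions on \<open>nat\<close>, made unique by extensionality on their index set.
\<close>

definition baseline_param_space :: "nat \<Rightarrow> (nat \<Rightarrow> real ^ 'p) set" where
  "baseline_param_space J = {1..<J} \<rightarrow>\<^sub>E UNIV"

definition positive_prob_vector :: "nat \<Rightarrow> (nat \<Rightarrow> real) \<Rightarrow> bool" where
  "positive_prob_vector J q \<longleftrightarrow>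
     q \<in> extensional {1..J} \<and> (\<forall>j\<in>{1..J}. 0 < q j) \<and> (\<Sum>j=1..J. q j) = 1"

definition baseline_logit_equations ::
    "nat \<Rightarrow> (nat \<Rightarrow> 'x \<Rightarrow> real ^ 'p) \<Rightarrow> 'x \<Rightarrow> (nat \<Rightarrow> real ^ 'p) \<Rightarrow> (nat \<Rightarrow> real) \<Rightarrow> bool" where
  "baseline_logit_equations J h x \<theta> q \<longleftrightarrow> (\<forall>j\<in>{1..<J}. ln (q j / q J) = h j x \<bullet> \<theta> j)"

definition baseline_prob ::
    "nat \<Rightarrow> (nat \<Rightarrow> 'x \<Rightarrow> real ^ 'p) \<Rightarrow> 'x \<Rightarrow> (nat \<Rightarrow> real ^ 'p) \<Rightarrow> nat \<Rightarrow> real" where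
  "baseline_prob J h x \<theta> =
     (THE q. positive_prob_vector J q \<and> baseline_logit_equations J h x \<theta> q)"

text \<open>
  The likelihood and the equivalence of orders are stated for an arbitrary model, given by its
  parameter space \<open>\<Theta>\<close> and its category probabilities \<open>\<pi> i \<theta> j\<close>.
\<close>

definition order_likelihood ::
    "nat \<Rightarrow> nat \<Rightarrow> (nat \<Rightarrow> nat \<Rightarrow> nat) \<Rightarrow> (nat \<Rightarrow> 'par \<Rightarrow> nat \<Rightarrow> real) \<Rightarrow> (nat \<Rightarrow> nat) \<Rightarrow> 'par \<Rightarrow> real"
  where
  "order_likelihood m J Y \<pi> \<sigma> \<theta> =
     (\<Prod>i=1..m. fact (\<Sum>j=1..J. Y i j) / (\<Prod>j=1..J. fact (Y i (\<sigma> j)))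
        * (\<Prod>j=1..J. \<pi> i \<theta> j ^ Y i (\<sigma> j)))"

text \<open>
  For probability vectors the likelihood is bounded in \<open>\<theta>\<close> (lemma \<open>order_likelihood_bdd_above\<close>),
  so the real-valued supremum below is a genuine one.
\<close>

definition order_equiv ::
    "'par set \<Rightarrow> nat \<Rightarrow> nat \<Rightarrow> (nat \<Rightarrow> nat \<Rightarrow> nat) \<Rightarrow> (nat \<Rightarrow> 'par \<Rightarrow> nat \<Rightarrow> real)
      \<Rightarrow> (nat \<Rightarrow> nat) \<Rightarrow> (nat \<Rightarrow> nat) \<Rightarrow> bool"
  where
  "order_equiv \<Theta> m J Y \<pi> \<sigma>1 \<sigma>2 \<longleftrightarrow>
     (SUP \<theta>\<in>\<Theta>. order_likelihood m J Y \<pi> \<sigma>1 \<theta>) = (SUP \<theta>\<in>\<Theta>. order_likelihood m J Y \<pi> \<sigma>2 \<theta>)"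

lemma baseline_prob_ex1:
  fixes h :: "nat \<Rightarrow> 'x \<Rightarrow> real ^ 'p"
  assumes J: "1 \<le> J"
  shows "\<exists>!q. positive_prob_vector J q \<and> baseline_logit_equations J h x \<theta> q"
proof -
  define e where "e j = (if j = J then 1 else exp (h j x \<bullet> \<theta> j))" for j
  define S where "S = (\<Sum>j=1..J. e j)"
  have epos: "0 < e j" for j by (simp add: e_def)
  have Spos: "0 < S" unfolding S_def using J epos by (intro sum_pos) auto
  show ?thesis
  proof (rule ex1I[where a = "\<lambda>j\<in>{1..J}. e j / S"])
    have "(\<Sum>j=1..J. e j / S) = 1"
      using Spos by (simp add: S_def flip: sum_divide_distrib)
    then show "positive_prob_vector J (\<lambda>j\<in>{1..J}. e j / S) \<and>
        baseline_logit_equations J h x \<theta> (\<lambda>j\<in>{1..J}. e j / S)"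
      using J epos Spos
      by (auto simp: positive_prob_vector_def baseline_logit_equations_def e_def)
  next
    fix q assume q: "positive_prob_vector J q \<and> baseline_logit_equations J h x \<theta> q"
    have pos: "0 < q j" if "j \<in> {1..J}" for j
      using q that by (auto simp: positive_prob_vector_def)
    have qJ: "0 < q J" using pos J by simp
    have eq: "q j = e j * q J" if j: "j \<in> {1..J}" for j
    proof (cases "j = J")
      case False
      then have "ln (q j / q J) = h j x \<bullet> \<theta> j"
        using q j by (auto simp: baseline_logit_equations_def)
      then have "exp (h j x \<bullet> \<theta> j) = q j / q J"
        using pos[OF j] qJ by (metis divide_pos_pos exp_ln)
      then show ?thesis using False qJ by (simp add: e_def)
    qed (simp add: e_def)
    have "1 = (\<Sum>j=1..J. q j)" using q by (simp add: positive_prob_vector_def)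
    also have "\<dots> = (\<Sum>j=1..J. e j * q J)" by (intro sum.cong refl eq)
    also have "\<dots> = S * q J" by (simp add: S_def sum_distrib_right)
    finally have "q J = 1 / S" using Spos by (simp add: field_simps)
    then have "q j = e j / S" if "j \<in> {1..J}" for j using eq[OF that] by simp
    moreover have "q \<in> extensional {1..J}" using q by (simp add: positive_prob_vector_def)
    ultimately show "q = (\<lambda>j\<in>{1..J}. e j / S)"
      by (intro extensionalityI[of _ "{1..J}"]) auto
  qed
qed

lemma order_likelihood_bdd_above:
  assumes "\<And>i \<theta>. i \<in> {1..m} \<Longrightarrow> \<theta> \<in> \<Theta> \<Longrightarrow> positive_prob_vector J (\<pi> i \<theta>)"
  shows "bdd_above (order_likelihood m J Y \<pi> \<sigma> ` \<Theta>)"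
proof (rule bdd_aboveI2)
  fix \<theta> assume t: "\<theta> \<in> \<Theta>"
  have p: "0 \<le> \<pi> i \<theta> j \<and> \<pi> i \<theta> j \<le> 1" if i: "i \<in> {1..m}" and j: "j \<in> {1..J}" for i j
  proof -
    have P: "\<And>k. k \<in> {1..J} \<Longrightarrow> 0 < \<pi> i \<theta> k" "(\<Sum>k=1..J. \<pi> i \<theta> k) = 1"
      using assms[OF i t] by (auto simp: positive_prob_vector_def)
    have "\<pi> i \<theta> j \<le> (\<Sum>k=1..J. \<pi> i \<theta> k)"
      using P(1) j by (intro member_le_sum) (auto intro: less_imp_le)
    then show ?thesis using P j by (simp add: less_imp_le)
  qed
  have b: "0 \<le> (\<Prod>j=1..J. \<pi> i \<theta> j ^ Y i (\<sigma> j)) \<and> (\<Prod>j=1..J. \<pi> i \<theta> j ^ Y i (\<sigma> j)) \<le> 1"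
    if "i \<in> {1..m}" for i
    using p[OF that] by (intro conjI prod_nonneg prod_le_1) (auto intro: power_le_one)
  show "order_likelihood m J Y \<pi> \<sigma> \<theta> \<le>
      (\<Prod>i=1..m. fact (\<Sum>j=1..J. Y i j) / (\<Prod>j=1..J. fact (Y i (\<sigma> j))))"
    unfolding order_likelihood_def
  proof (intro prod_mono conjI)
    fix i assume i: "i \<in> {1..m}"
    have c: "(0::real) \<le> fact (\<Sum>j=1..J. Y i j) / (\<Prod>j=1..J. fact (Y i (\<sigma> j)))"
      by (intro divide_nonneg_nonneg prod_nonneg) auto
    show "0 \<le> fact (\<Sum>j=1..J. Y i j) / (\<Prod>j=1..J. fact (Y i (\<sigma> j)))
        * (\<Prod>j=1..J. \<pi> i \<theta> j ^ Y i (\<sigma> j))"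
      using c b[OF i] by (intro mult_nonneg_nonneg) auto
    show "fact (\<Sum>j=1..J. Y i j) / (\<Prod>j=1..J. fact (Y i (\<sigma> j)))
        * (\<Prod>j=1..J. \<pi> i \<theta> j ^ Y i (\<sigma> j))
        \<le> fact (\<Sum>j=1..J. Y i j) / (\<Prod>j=1..J. fact (Y i (\<sigma> j)))"
      using mult_left_mono[OF conjunct2[OF b[OF i]] c] by simp
  qed
qed

end

(*
  With equal predictors the baseline category plays no special role: setting the coefficient of
  category J to 0, the log odds of any category a against any category b are linear in the common
  predictor, with coefficient the difference of those of a and b. Permuting the category
  probabilities is therefore a change of parameter, so all orders yield the same set of
  likelihood values.
*)
theory Submission
  imports Defs
begin

definition baseline_coeff :: "nat \<Rightarrow> (nat \<Rightarrow> real ^ 'p) \<Rightarrow> nat \<Rightarrow> real ^ 'p" where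
  "baseline_coeff J \<theta> k = (if k = J then 0 else \<theta> k)"

text \<open>Category \<open>\<rho> J\<close> takes over the role of the baseline, so its coefficient
  is subtracted from all the others: the coefficient at position \<open>J\<close> is again 0.
  Restricting to \<open>{1..<J}\<close> makes the result an element of the extensional parameter
  space.\<close>

definition permute_param :: "nat \<Rightarrow> (nat \<Rightarrow> nat) \<Rightarrow> (nat \<Rightarrow> real ^ 'p) \<Rightarrow> nat \<Rightarrow> real ^ 'p" where
  "permute_param J \<rho> \<theta> =
     (\<lambda>j\<in>{1..<J}. baseline_coeff J \<theta> (\<rho> j) - baseline_coeff J \<theta> (\<rho> J))"

lemma permute_param_in_space: "permute_param J \<rho> \<theta> \<in> baseline_param_space J"
  by (simp add: permute_param_def baseline_param_space_def)

lemma positive_prob_vector_permute: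
  assumes q: "positive_prob_vector J q" and \<rho>: "\<rho> permutes {1..J}"
  shows "positive_prob_vector J (\<lambda>j\<in>{1..J}. q (\<rho> j))"
proof -
  have "(\<Sum>j=1..J. q (\<rho> j)) = (\<Sum>j=1..J. q j)"
    using sum.permute[OF \<rho>, of q] by (simp add: o_def)
  then show ?thesis
    using q permutes_in_image[OF \<rho>] by (auto simp: positive_prob_vector_def)
qed

text \<open>The term \<open>ln (q J)\<close> cancels when the log odds of \<open>a\<close> and
  \<open>b\<close> against \<open>J\<close> are subtracted. Since both are inner products with the
  same vector \<open>g\<close>, their difference is one as well. The cases \<open>a = J\<close> and
  \<open>b = J\<close> fit in because \<open>baseline_coeff\<close> is 0 there.\<close>

lemma baseline_log_odds:
  fixes h :: "nat \<Rightarrow> 'x \<Rightarrow> real ^ 'p"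
  assumes q: "positive_prob_vector J q" "baseline_logit_equations J h x \<theta> q"
    and h: "\<And>j. j \<in> {1..<J} \<Longrightarrow> h j x = g"
    and a: "a \<in> {1..J}" and b: "b \<in> {1..J}"
  shows "ln (q a / q b) = g \<bullet> (baseline_coeff J \<theta> a - baseline_coeff J \<theta> b)"
proof -
  have pos: "0 < q k" if "k \<in> {1..J}" for k
    using q(1) that by (auto simp: positive_prob_vector_def)
  have qJ: "0 < q J" using pos a by simp
  have odds: "ln (q k) - ln (q J) = g \<bullet> baseline_coeff J \<theta> k" if k: "k \<in> {1..J}" for k
  proof (cases "k = J")
    case False
    then have "ln (q k / q J) = g \<bullet> \<theta> k"
      using q(2) h[of k] k by (auto simp: baseline_logit_equations_def)
    then show ?thesis
      using False pos[OF k] qJ by (simp add: baseline_coeff_def ln_div)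
  qed (simp add: baseline_coeff_def)
  show ?thesis
    using odds[OF a] odds[OF b] pos[OF a] pos[OF b] by (simp add: ln_div inner_diff_right)
qed

text \<open>The permuted probability vector is positive, sums to 1 and solves the model equations at
  the permuted parameter; uniqueness of the solution then gives the equality.\<close>

lemma baseline_prob_permute_param:
  fixes h :: "nat \<Rightarrow> 'x \<Rightarrow> real ^ 'p"
  assumes J: "1 \<le> J" and \<rho>: "\<rho> permutes {1..J}"
    and h: "\<And>j. j \<in> {1..<J} \<Longrightarrow> h j x = g"
  shows "baseline_prob J h x (permute_param J \<rho> \<theta>) = (\<lambda>j\<in>{1..J}. baseline_prob J h x \<theta> (\<rho> j))"
proof -
  define q where "q = baseline_prob J h x \<theta>"
  have q: "positive_prob_vector J q" "baseline_logit_equations J h x \<theta> q"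
    using theI'[OF baseline_prob_ex1[OF J, of h x \<theta>]] by (simp_all add: q_def baseline_prob_def)
  have "baseline_logit_equations J h x (permute_param J \<rho> \<theta>) (\<lambda>j\<in>{1..J}. q (\<rho> j))"
    unfolding baseline_logit_equations_def
  proof
    fix j assume j: "j \<in> {1..<J}"
    have "\<rho> j \<in> {1..J}" "\<rho> J \<in> {1..J}"
      using permutes_in_image[OF \<rho>] j J by auto
    \<comment> \<open>Log odds of \<open>\<rho> j\<close> against \<open>\<rho> J\<close>, the
      category that now sits at the baseline position.\<close>
    then have "ln (q (\<rho> j) / q (\<rho> J)) = h j x \<bullet> permute_param J \<rho> \<theta> j"
      using baseline_log_odds[OF q h] h[OF j] j by (simp add: permute_param_def)
    then show "ln ((\<lambda>j\<in>{1..J}. q (\<rho> j)) j / (\<lambda>j\<in>{1..J}. q (\<rho> j)) J)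
        = h j x \<bullet> permute_param J \<rho> \<theta> j"
      using j J by simp
  qed
  then show ?thesis
    unfolding q_def[symmetric] baseline_prob_def[of J h x "permute_param J \<rho> \<theta>"]
    by (intro the1_equality[OF baseline_prob_ex1[OF J]] conjI
        positive_prob_vector_permute[OF q(1) \<rho>])
qed

text \<open>With \<open>\<rho> = inv \<sigma> \<circ> \<tau>\<close> one has
  \<open>\<sigma> \<circ> \<rho> = \<tau>\<close>, so reindexing the products over categories by
  \<open>\<rho>\<close> moves the permutation from the counts to the probabilities. This holds for
  any model.\<close>

lemma order_likelihood_permute:
  assumes \<sigma>: "\<sigma> permutes {1..J}" and \<tau>: "\<tau> permutes {1..J}"
    and \<pi>: "\<And>i j. i \<in> {1..m} \<Longrightarrow> j \<in> {1..J} \<Longrightarrow> \<pi> i \<theta>' j = \<pi> i \<theta> ((inv \<sigma> \<circ> \<tau>) j)"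
  shows "order_likelihood m J Y \<pi> \<tau> \<theta>' = order_likelihood m J Y \<pi> \<sigma> \<theta>"
proof -
  define \<rho> where "\<rho> = inv \<sigma> \<circ> \<tau>"
  have \<rho>: "\<rho> permutes {1..J}"
    unfolding \<rho>_def by (intro permutes_compose permutes_inv \<sigma> \<tau>)
  have \<sigma>\<rho>: "\<sigma> (\<rho> j) = \<tau> j" for j
    by (simp add: \<rho>_def permutes_inverses[OF \<sigma>])
  have coeff: "(\<Prod>j=1..J. fact (Y i (\<tau> j))) = (\<Prod>j=1..J. fact (Y i (\<sigma> j)) :: real)" for i
    using prod.permute[OF \<rho>, of "\<lambda>j. fact (Y i (\<sigma> j)) :: real"] by (simp add: o_def \<sigma>\<rho>)
  have probs: "(\<Prod>j=1..J. \<pi> i \<theta>' j ^ Y i (\<tau> j)) = (\<Prod>j=1..J. \<pi> i \<theta> j ^ Y i (\<sigma> j))"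
    if i: "i \<in> {1..m}" for i
  proof -
    have "(\<Prod>j=1..J. \<pi> i \<theta>' j ^ Y i (\<tau> j)) = (\<Prod>j=1..J. \<pi> i \<theta> (\<rho> j) ^ Y i (\<sigma> (\<rho> j)))"
      using \<pi>[OF i] by (intro prod.cong refl) (simp add: \<sigma>\<rho>, simp add: \<rho>_def)
    also have "\<dots> = (\<Prod>j=1..J. \<pi> i \<theta> j ^ Y i (\<sigma> j))"
      using prod.permute[OF \<rho>, of "\<lambda>j. \<pi> i \<theta> j ^ Y i (\<sigma> j)"] by (simp add: o_def)
    finally show "(\<Prod>j=1..J. \<pi> i \<theta>' j ^ Y i (\<tau> j)) = (\<Prod>j=1..J. \<pi> i \<theta> j ^ Y i (\<sigma> j))" .
  qed
  show ?thesis
    unfolding order_likelihood_def by (intro prod.cong refl) (simp only: coeff probs)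
qed

text \<open>The value at \<open>\<theta>\<close> under order \<open>\<sigma>\<close> is attained
  under order \<open>\<tau>\<close> at the parameter permuted by
  \<open>inv \<sigma> \<circ> \<tau>\<close>. One permuted parameter serves all settings
  \<open>i\<close> at once, although \<open>g i\<close> varies.\<close>

lemma baseline_likelihood_image_subset:
  fixes h :: "nat \<Rightarrow> 'x \<Rightarrow> real ^ 'p"
  assumes J: "1 \<le> J" and \<sigma>: "\<sigma> permutes {1..J}" and \<tau>: "\<tau> permutes {1..J}"
    and h: "\<And>i j. i \<in> {1..m} \<Longrightarrow> j \<in> {1..<J} \<Longrightarrow> h j (x i) = g i"
  shows "order_likelihood m J Y (\<lambda>i. baseline_prob J h (x i)) \<sigma> ` baseline_param_space J
    \<subseteq> order_likelihood m J Y (\<lambda>i. baseline_prob J h (x i)) \<tau> ` baseline_param_space J"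
proof (intro image_subsetI image_eqI)
  fix \<theta> :: "nat \<Rightarrow> real ^ 'p"
  have \<rho>: "inv \<sigma> \<circ> \<tau> permutes {1..J}"
    by (intro permutes_compose permutes_inv \<sigma> \<tau>)
  have "baseline_prob J h (x i) (permute_param J (inv \<sigma> \<circ> \<tau>) \<theta>) j
      = baseline_prob J h (x i) \<theta> ((inv \<sigma> \<circ> \<tau>) j)"
    if "i \<in> {1..m}" "j \<in> {1..J}" for i j
    using baseline_prob_permute_param[OF J \<rho>, of h "x i" "g i" \<theta>] h[OF that(1)] that(2) by simp
  then show "order_likelihood m J Y (\<lambda>i. baseline_prob J h (x i)) \<sigma> \<theta>
      = order_likelihood m J Y (\<lambda>i. baseline_prob J h (x i)) \<tau> (permute_param J (inv \<sigma> \<circ> \<tau>) \<theta>)"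
    by (intro order_likelihood_permute[OF \<sigma> \<tau>, symmetric])
  show "permute_param J (inv \<sigma> \<circ> \<tau>) \<theta> \<in> baseline_param_space J"
    by (rule permute_param_in_space)
qed

theorem theorem2p5:
  fixes m J :: nat
    and x :: "nat \<Rightarrow> real ^ 'd"
    and Y :: "nat \<Rightarrow> nat \<Rightarrow> nat"
    and h :: "nat \<Rightarrow> real ^ 'd \<Rightarrow> real ^ 'p"
  assumes "1 \<le> m" and "3 \<le> J"
    and "inj_on x {1..m}"
    and "\<forall>i\<in>{1..m}. 0 < (\<Sum>j=1..J. Y i j)"
    and "\<forall>i\<in>{1..m}. \<forall>j\<in>{1..<J}. \<forall>k\<in>{1..<J}. h j (x i) = h k (x i)"
  shows "\<forall>\<sigma>1 \<sigma>2. \<sigma>1 permutes {1..J} \<longrightarrow> \<sigma>2 permutes {1..J} \<longrightarrow>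
    order_equiv (baseline_param_space J) m J Y (\<lambda>i. baseline_prob J h (x i)) \<sigma>1 \<sigma>2"
proof (intro allI impI)
  fix \<sigma>1 \<sigma>2 :: "nat \<Rightarrow> nat"
  assume \<sigma>: "\<sigma>1 permutes {1..J}" "\<sigma>2 permutes {1..J}"
  have J: "1 \<le> J" using assms(2) by simp
  \<comment> \<open>The first predictor represents the common value; index 1 lies below
    \<open>J\<close> because \<open>3 \<le> J\<close>.\<close>
  have h: "h j (x i) = h 1 (x i)" if "i \<in> {1..m}" "j \<in> {1..<J}" for i j
  proof -
    have "1 \<in> {1..<J}" using assms(2) by simp
    then show ?thesis using assms(5) that by blast
  qed
  \<comment> \<open>The two inclusions are the same lemma with the orders exchanged; equal sets of
    values have equal suprema.\<close>
  have "order_likelihood m J Y (\<lambda>i. baseline_prob J h (x i)) \<sigma>1 ` baseline_param_space J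
      = order_likelihood m J Y (\<lambda>i. baseline_prob J h (x i)) \<sigma>2 ` baseline_param_space J"
    by (intro equalityI baseline_likelihood_image_subset[where g = "\<lambda>i. h 1 (x i)"] J \<sigma> h)
  then show "order_equiv (baseline_param_space J) m J Y (\<lambda>i. baseline_prob J h (x i)) \<sigma>1 \<sigma>2"
    by (simp only: order_equiv_def)
qed

end
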